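(* Consider any voting rule that is based on numerical scores and is monotone. Let $S$ be a set of weighted non-manipulators' votes (possibly top-truncated), let the weights of a set $T$ of manipulators' votes be given, and let $h$ be a (disliked) candidate. If the manipulators can cast top-truncated votes (with the given weights) so that $h$ does not win the election $S\cup T$, then the manipulators can also cast complete votes (with the same weights) so that $h$ does not win the election $S\cup T$.
   Context: An election has a finite set $C$ of candidates and voters with non-negative integer weights; a vote of weight $w$ counts as $w$ identical votes. A top-truncated vote is a linear order over a non-empty subset of $C$; the unranked candidates are regarded as tied with each other and below all ranked ones. A complete vote ranks all of $C$ and is a special case. A voting rule is based on numerical scores if it assigns to each candidate a numerical score determined by the votes (complete or top-truncated), and the winners are exactly the candidates with highest score. Such a rule is monotone if, whenever a voter changes his or her vote from $\succ$ to $\succ'$ in such a way that $\{b: a\succ b\}\subseteq\{b: a\succ' b\}$ for a candidate $a$, the score of $a$ does not decrease. That $h$ does not win means that $h$ is not in the set of winners. *)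

theory Defs
  imports Complex_Main
begin

text \<open>
  A vote is its linear order as a (reflexive) relation: \<open>(a, b) \<in> r\<close> means that \<open>a\<close> is ranked at
  or above \<open>b\<close>. Reflexivity makes the set of ranked candidates equal to \<open>Field r\<close>, so a vote
  ranking a single candidate \<open>a\<close> is \<open>{(a, a)}\<close>.
\<close>

definition truncated_vote :: "'c set \<Rightarrow> 'c rel \<Rightarrow> bool" where
  "truncated_vote C r \<longleftrightarrow> (\<exists>A \<subseteq> C. A \<noteq> {} \<and> linear_order_on A r)"

definition complete_vote :: "'c set \<Rightarrow> 'c rel \<Rightarrow> bool" where
  "complete_vote C r \<longleftrightarrow> linear_order_on C r"

text \<open>The candidates \<open>b\<close> with \<open>a \<succ> b\<close>; unranked candidates are tied below all ranked ones.\<close>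

definition below :: "'c set \<Rightarrow> 'c rel \<Rightarrow> 'c \<Rightarrow> 'c set" where
  "below C r a = {b \<in> C. a \<in> Field r \<and> (b \<in> Field r \<longrightarrow> (a, b) \<in> r \<and> a \<noteq> b)}"

text \<open>
  Rules act on lists of unweighted votes, the position identifying the voter. Rules need not be
  anonymous; anonymous ones are those that factor through \<open>mset\<close>.
\<close>

type_synonym 'c profile = "'c rel list"

definition expand :: "('c rel \<times> nat) list \<Rightarrow> 'c profile" where
  "expand V = concat (map (\<lambda>(r, w). replicate w r) V)"

definition score_based ::
  "'c set \<Rightarrow> ('c profile \<Rightarrow> 'c set) \<Rightarrow> ('c profile \<Rightarrow> 'c \<Rightarrow> real) \<Rightarrow> bool" where
  "score_based C winners score \<longleftrightarrow>
     (\<forall>P. (\<forall>r \<in> set P. truncated_vote C r) \<longrightarrow>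
        winners P = {c \<in> C. \<forall>d \<in> C. score P d \<le> score P c})"

definition monotone_score :: "'c set \<Rightarrow> ('c profile \<Rightarrow> 'c \<Rightarrow> real) \<Rightarrow> bool" where
  "monotone_score C score \<longleftrightarrow>
     (\<forall>P i r' a. (\<forall>r \<in> set P. truncated_vote C r) \<longrightarrow> i < length P \<longrightarrow> truncated_vote C r' \<longrightarrow>
        a \<in> C \<longrightarrow> below C (P ! i) a \<subseteq> below C r' a \<longrightarrow> score P a \<le> score (P[i := r']) a)"

end

theory Submission
  imports Defs
begin

text \<open>
  If \<open>h\<close> does not win, some \<open>d\<close> has a higher score. Extend every manipulator's vote by putting the
  unranked candidates below the ranked ones, with \<open>h\<close> last if it was unranked. No candidate then
  dominates fewer candidates than before, and \<open>h\<close> dominates no additional ones. By monotonicity, the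
  score of \<open>d\<close> does not decrease, while that of \<open>h\<close> does not increase.
\<close>

lemma Field_linear_order_on: "linear_order_on A r \<Longrightarrow> Field r = A"
  unfolding order_on_defs refl_on_def Field_def by blast

lemma complete_vote_imp_truncated_vote:
  "complete_vote C r \<Longrightarrow> C \<noteq> {} \<Longrightarrow> truncated_vote C r"
  unfolding complete_vote_def truncated_vote_def by blast

text \<open>Since larger in the relation means ranked higher, \<open>A \<times> B\<close> places the
  block \<open>A\<close> above the block \<open>B\<close>. This serves twice: to append a last
  candidate, and to append the unranked candidates to a vote.\<close>

lemma linear_order_on_ordinal_sum:
  assumes "linear_order_on A r" "linear_order_on B s" "A \<inter> B = {}"
  shows "linear_order_on (A \<union> B) (r \<union> s \<union> A \<times> B)"
  unfolding order_on_defs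
proof (intro conjI)
  have r: "r \<subseteq> A \<times> A" "refl_on A r" "trans r" "antisym r" "total_on A r"
    and s: "s \<subseteq> B \<times> B" "refl_on B s" "trans s" "antisym s" "total_on B s"
    using assms(1,2) by (simp_all add: order_on_defs)
  show "r \<union> s \<union> A \<times> B \<subseteq> (A \<union> B) \<times> (A \<union> B)"
    using r(1) s(1) by blast
  show "refl_on (A \<union> B) (r \<union> s \<union> A \<times> B)"
    using r(2) s(2) unfolding refl_on_def by blast
  show "trans (r \<union> s \<union> A \<times> B)"
  proof (rule transI)
    fix x y z
    assume "(x, y) \<in> r \<union> s \<union> A \<times> B" "(y, z) \<in> r \<union> s \<union> A \<times> B"
    then show "(x, z) \<in> r \<union> s \<union> A \<times> B"
      using r(1) s(1) assms(3) transD[OF r(3), of x y z] transD[OF s(3), of x y z] by auto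
  qed
  show "antisym (r \<union> s \<union> A \<times> B)"
  proof (rule antisymI)
    fix x y
    assume "(x, y) \<in> r \<union> s \<union> A \<times> B" "(y, x) \<in> r \<union> s \<union> A \<times> B"
    then show "x = y"
      using r(1) s(1) assms(3) antisymD[OF r(4), of x y] antisymD[OF s(4), of x y] by auto
  qed
  show "total_on (A \<union> B) (r \<union> s \<union> A \<times> B)"
    using r(5) s(5) unfolding total_on_def by blast
qed

text \<open>The rest of \<open>B\<close> is ordered by the well-ordering theorem and
  \<open>h\<close> is appended. Membership of \<open>h\<close> is only a premise of the second
  property, so that a vote already ranking \<open>h\<close> needs no separate treatment.\<close>

lemma linear_order_on_with_last:
  obtains s where "linear_order_on B s" "\<And>b. b \<in> B \<Longrightarrow> h \<in> B \<Longrightarrow> (b, h) \<in> s"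
proof (cases "h \<in> B")
  case True
  obtain t where t: "linear_order_on (B - {h}) t"
    using well_order_on unfolding well_order_on_def by blast
  have "linear_order_on {h} {(h, h)}"
    by (simp add: order_on_defs refl_on_def trans_def antisym_def)
  from linear_order_on_ordinal_sum[OF t this]
  have "linear_order_on B (t \<union> {(h, h)} \<union> (B - {h}) \<times> {h})"
    using True by (simp add: insert_absorb)
  then show ?thesis
    by (rule that) blast
next
  case False
  obtain t where "linear_order_on B t"
    using well_order_on unfolding well_order_on_def by blast
  with False show ?thesis
    by (intro that) auto
qed

text \<open>A ranked candidate already counts every unranked one as below it, so ordering the latter
  underneath leaves its \<open>below\<close> set unchanged. An unranked candidate starts from the
  empty set, so it can only gain, and \<open>h\<close> gains nothing in last place.\<close>

lemma truncated_vote_completion: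
  assumes "truncated_vote C r" "h \<in> C"
  obtains r' where "complete_vote C r'" "\<And>d. below C r d \<subseteq> below C r' d"
    "below C r' h \<subseteq> below C r h"
proof -
  obtain A where A: "A \<subseteq> C" "linear_order_on A r"
    using assms(1) unfolding truncated_vote_def by blast
  obtain s where s: "linear_order_on (C - A) s"
    and last: "\<And>b. b \<in> C - A \<Longrightarrow> h \<in> C - A \<Longrightarrow> (b, h) \<in> s"
    using linear_order_on_with_last[of "C - A" h] by metis
  let ?r = "r \<union> s \<union> A \<times> (C - A)"
  have lin: "linear_order_on C ?r"
    using linear_order_on_ordinal_sum[OF A(2) s] A(1) by (simp add: Un_absorb1)
  have r_sub: "r \<subseteq> A \<times> A" and s_sub: "s \<subseteq> (C - A) \<times> (C - A)" and antisym: "antisym ?r"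
    using A(2) s lin by (simp_all add: order_on_defs)
  have Field_r: "Field r = A" and Field: "Field ?r = C"
    using Field_linear_order_on A(2) lin by blast+
  show ?thesis
  proof
    show "complete_vote C ?r"
      using lin unfolding complete_vote_def .
    show "below C r d \<subseteq> below C ?r d" for d
      using A(1) unfolding below_def Field Field_r by blast
    show "below C ?r h \<subseteq> below C r h"
    proof
      fix b
      assume "b \<in> below C ?r h"
      then have b: "b \<in> C" "(h, b) \<in> ?r" "h \<noteq> b"
        unfolding below_def Field by auto
      \<comment> \<open>An unranked \<open>h\<close> would be last in \<open>s\<close>, hence above
        no other candidate.\<close>
      have "h \<in> A"
      proof (rule ccontr)
        assume "h \<notin> A"
        with b r_sub s_sub assms(2) have "b \<in> C - A" "h \<in> C - A"
          by auto
        with last b antisymD[OF antisym, of h b] show False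
          by blast
      qed
      \<comment> \<open>Now \<open>(h, b)\<close> lies in \<open>r\<close> or \<open>b\<close> is
        unranked; both count for \<open>below C r h\<close>.\<close>
      with b s_sub show "b \<in> below C r h"
        unfolding below_def Field_r by blast
    qed
  qed
qed

lemma monotone_scoreD:
  assumes "monotone_score C score" "\<forall>r \<in> set P. truncated_vote C r" "i < length P"
    and "truncated_vote C r'" "a \<in> C" "below C (P ! i) a \<subseteq> below C r' a"
  shows "score P a \<le> score (P[i := r']) a"
  using assms unfolding monotone_score_def by blast

text \<open>Votes are replaced one at a time from the left. The arbitrary prefix \<open>Q\<close>
  collects the votes already replaced, and at the start it can hold the votes of the
  non-manipulators.\<close>

lemma monotone_score_pointwise:
  assumes mono: "monotone_score C score" and "a \<in> C"
    and "list_all2 (\<lambda>r r'. truncated_vote C r \<and> truncated_vote C r' \<and>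
           below C r a \<subseteq> below C r' a) P P'"
    and "\<forall>r \<in> set Q. truncated_vote C r"
  shows "score (Q @ P) a \<le> score (Q @ P') a"
  using assms(3,4)
proof (induction arbitrary: Q rule: list_all2_induct)
  case Nil
  then show ?case by simp
next
  case (Cons r rs r' rs')
  have "\<forall>q \<in> set rs. truncated_vote C q"
    using Cons.hyps(2) by (induction rule: list_all2_induct) simp_all
  then have "\<forall>q \<in> set (Q @ r # rs). truncated_vote C q"
    using Cons.hyps(1) Cons.prems by (simp add: ball_Un)
  moreover have "below C ((Q @ r # rs) ! length Q) a \<subseteq> below C r' a"
    using Cons.hyps(1) by simp
  ultimately have "score (Q @ r # rs) a \<le> score ((Q @ r # rs)[length Q := r']) a"
    using Cons.hyps(1) \<open>a \<in> C\<close> by (intro monotone_scoreD[OF mono]) simp_all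
  also have "\<dots> = score ((Q @ [r']) @ rs) a"
    by simp
  also have "\<dots> \<le> score ((Q @ [r']) @ rs') a"
    using Cons.prems Cons.hyps(1) by (intro Cons.IH) simp
  finally show ?case by simp
qed

lemma expand_append: "expand (V @ W) = expand V @ expand W"
  unfolding expand_def by simp

lemma set_expand_subset: "set (expand V) \<subseteq> fst ` set V"
  unfolding expand_def by force

text \<open>Both lists are paired with the same weights, so corresponding votes have equally many
  copies, which stay aligned position by position.\<close>

lemma list_all2_expand_zip:
  assumes "list_all2 R T T'"
  shows "list_all2 R (expand (zip T ws)) (expand (zip T' ws))"
  using assms
proof (induction arbitrary: ws rule: list_all2_induct)
  case Nil
  then show ?case by (simp add: expand_def)
next
  case (Cons r T r' T')
  then show ?case
    by (cases ws)
      (auto simp: expand_def list_all2_conv_all_nth[of R "replicate _ _"] intro: list_all2_appendI)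
qed

theorem theorem12:
  fixes C :: "'c set"
    and winners :: "'c profile \<Rightarrow> 'c set"
    and score :: "'c profile \<Rightarrow> 'c \<Rightarrow> real"
    and S :: "('c rel \<times> nat) list"
    and weights :: "nat list"
    and h :: 'c
  assumes "finite C"
    and "score_based C winners score"
    and "monotone_score C score"
    and "\<forall>(r, w) \<in> set S. truncated_vote C r"
    and "h \<in> C"
    and "\<exists>T. length T = length weights \<and> (\<forall>r \<in> set T. truncated_vote C r) \<and>
             h \<notin> winners (expand (S @ zip T weights))"
  shows "\<exists>T. length T = length weights \<and> (\<forall>r \<in> set T. complete_vote C r) \<and>
             h \<notin> winners (expand (S @ zip T weights))"
proof -
  obtain T where len: "length T = length weights" and T: "\<forall>r \<in> set T. truncated_vote C r"
    and lose: "h \<notin> winners (expand (S @ zip T weights))"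
    using assms(6) by blast
  have "\<exists>r'. complete_vote C r' \<and> (\<forall>d. below C r d \<subseteq> below C r' d) \<and>
      below C r' h \<subseteq> below C r h" if "r \<in> set T" for r
    using truncated_vote_completion[of C r h] T that \<open>h \<in> C\<close> by metis
  then obtain f where f: "\<And>r. r \<in> set T \<Longrightarrow> complete_vote C (f r)"
      "\<And>r d. r \<in> set T \<Longrightarrow> below C r d \<subseteq> below C (f r) d"
      "\<And>r. r \<in> set T \<Longrightarrow> below C (f r) h \<subseteq> below C r h"
    by metis
  \<comment> \<open>Truncated votes rank a non-empty set; here \<open>h \<in> C\<close> ensures
    this.\<close>
  have f_trunc: "truncated_vote C (f r)" if "r \<in> set T" for r
    using complete_vote_imp_truncated_vote f(1)[OF that] \<open>h \<in> C\<close> by blast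
  have S: "\<forall>r \<in> set (expand S). truncated_vote C r"
    using set_expand_subset[of S] assms(4) by fastforce
  have profile: "\<forall>r \<in> set (expand (S @ zip V weights)). truncated_vote C r"
    if "\<forall>r \<in> set V. truncated_vote C r" for V
  proof -
    have "set (expand (zip V weights)) \<subseteq> set V"
      using set_expand_subset[of "zip V weights"] by (fastforce dest: set_zip_leftD)
    with S that show ?thesis
      by (auto simp: expand_append)
  qed
  let ?P = "expand (S @ zip T weights)" and ?P' = "expand (S @ zip (map f T) weights)"
  obtain d where d: "d \<in> C" "score ?P h < score ?P d"
    using assms(2) profile[OF T] lose \<open>h \<in> C\<close> unfolding score_based_def
    by (auto simp: not_le)
  \<comment> \<open>Monotonicity only bounds scores from below. For \<open>h\<close> it is therefore
    applied to the reverse change, from the completed votes back to the truncated ones.\<close>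
  have "list_all2 (\<lambda>r r'. truncated_vote C r \<and> truncated_vote C r' \<and>
      below C r h \<subseteq> below C r' h) (map f T) T"
    using T f(3) f_trunc by (auto simp: list_all2_conv_all_nth)
  from monotone_score_pointwise[OF assms(3) \<open>h \<in> C\<close> list_all2_expand_zip[OF this] S]
  have le_h: "score ?P' h \<le> score ?P h"
    by (simp add: expand_append)
  \<comment> \<open>For \<open>d\<close> the change is taken in the forward direction.\<close>
  have "list_all2 (\<lambda>r r'. truncated_vote C r \<and> truncated_vote C r' \<and>
      below C r d \<subseteq> below C r' d) T (map f T)"
    using T f(2) f_trunc by (simp add: list_all2_conv_all_nth)
  from monotone_score_pointwise[OF assms(3) d(1) list_all2_expand_zip[OF this] S]
  have "score ?P d \<le> score ?P' d"
    by (simp add: expand_append)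
  with d(2) le_h have "score ?P' h < score ?P' d"
    by simp
  moreover have "\<forall>r \<in> set ?P'. truncated_vote C r"
    using f_trunc by (intro profile) auto
  ultimately have "h \<notin> winners ?P'"
    using assms(2) d(1) unfolding score_based_def by (auto simp: not_le)
  then show ?thesis
    using len f(1) by (intro exI[of _ "map f T"]) auto
qed

end
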